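(* Let $T=(V,E)$ be a directed tree, let $\lambda=\{\lambda_v\}_{v\in V}$ be a sequence of positive numbers and let $1\le p<\infty$. Assume the shift $S:\mathbf{L}^p(T,\lambda)\to\mathbf{L}^p(T,\lambda)$ is bounded. If $T$ has at least one vertex of outdegree at least $2$, then $S$ is not hypercyclic.
   Context: A directed graph $T=(V,E)$ consists of a countably infinite set $V$ of vertices and a set $E\subseteq V\times V$ of directed edges; it is always assumed locally finite (every vertex has finite indegree and finite outdegree). $T$ is a directed tree if it has no directed circuits (including loops $(v,v)$), its underlying undirected graph is connected, and every vertex has indegree $0$ or $1$. A root is a vertex of indegree $0$ (there is at most one, denoted $\mathrm{root}$; it need not exist). For $v\ne\mathrm{root}$, the parent $\operatorname{par}(v)$ is the unique $u$ with $(u,v)\in E$. The outdegree of $v$ is the number of $u$ with $(v,u)\in E$. $\mathbf{L}^p(T,\lambda)$ is the complex Banach space of functions $f:V\to\mathbb{C}$ with $\|f\|_p=\big(\sum_{v\in V}|f(v)|^p\lambda_v\big)^{1/p}<\infty$. The shift $S$ is defined by $(Sf)(v)=f(\operatorname{par}(v))$ if $v\neq\mathrm{root}$ and $(Sf)(\mathrm{root})=0$ (if there is a root). A bounded operator $A$ on a Banach space $\mathcal{B}$ is hypercyclic if there is $x\in\mathcal{B}$ such that $\{A^nx: n=0,1,2,\dots\}$ is dense in $\mathcal{B}$. *)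

theory Defs
  imports "HOL-Analysis.Infinite_Sum" "HOL-Library.Countable_Set"
begin

definition indegree :: "('v \<times> 'v) set \<Rightarrow> 'v \<Rightarrow> nat" where
  "indegree E v = card {u. (u, v) \<in> E}"

definition outdegree :: "('v \<times> 'v) set \<Rightarrow> 'v \<Rightarrow> nat" where
  "outdegree E v = card {u. (v, u) \<in> E}"

definition locally_finite_digraph :: "'v set \<Rightarrow> ('v \<times> 'v) set \<Rightarrow> bool" where
  "locally_finite_digraph V E \<longleftrightarrow>
     countable V \<and> infinite V \<and> E \<subseteq> V \<times> V \<and>
     (\<forall>v\<in>V. finite {u. (u, v) \<in> E} \<and> finite {u. (v, u) \<in> E})"

definition directed_tree :: "'v set \<Rightarrow> ('v \<times> 'v) set \<Rightarrow> bool" where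
  "directed_tree V E \<longleftrightarrow>
     locally_finite_digraph V E \<and>
     acyclic E \<and>
     (\<forall>u\<in>V. \<forall>v\<in>V. (u, v) \<in> (E \<union> E\<inverse>)\<^sup>*) \<and>
     (\<forall>v\<in>V. indegree E v = 0 \<or> indegree E v = 1)"

definition is_root :: "'v set \<Rightarrow> ('v \<times> 'v) set \<Rightarrow> 'v \<Rightarrow> bool" where
  "is_root V E v \<longleftrightarrow> v \<in> V \<and> indegree E v = 0"

definition parent :: "('v \<times> 'v) set \<Rightarrow> 'v \<Rightarrow> 'v" where
  "parent E v = (THE u. (u, v) \<in> E)"

text \<open>A function on the vertex set \<open>V\<close> is represented by a total function that vanishes
  outside \<open>V\<close>, so that equality of functions on \<open>V\<close> is HOL equality.\<close>

definition Lp :: "'v set \<Rightarrow> ('v \<Rightarrow> real) \<Rightarrow> real \<Rightarrow> ('v \<Rightarrow> complex) set" where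
  "Lp V lam p =
     {f. (\<forall>v. v \<notin> V \<longrightarrow> f v = 0) \<and> (\<lambda>v. cmod (f v) powr p * lam v) summable_on V}"

definition Lp_norm :: "'v set \<Rightarrow> ('v \<Rightarrow> real) \<Rightarrow> real \<Rightarrow> ('v \<Rightarrow> complex) \<Rightarrow> real" where
  "Lp_norm V lam p f = (\<Sum>\<^sub>\<infinity>v\<in>V. cmod (f v) powr p * lam v) powr (1 / p)"

definition shift :: "'v set \<Rightarrow> ('v \<times> 'v) set \<Rightarrow> ('v \<Rightarrow> complex) \<Rightarrow> 'v \<Rightarrow> complex" where
  "shift V E f v = (if v \<in> V \<and> \<not> is_root V E v then f (parent E v) else 0)"

lemma shift_add: "shift V E (\<lambda>v. f v + g v) = (\<lambda>v. shift V E f v + shift V E g v)"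
  by (simp add: shift_def fun_eq_iff)

lemma shift_scale: "shift V E (\<lambda>v. c * f v) = (\<lambda>v. c * shift V E f v)"
  by (simp add: shift_def fun_eq_iff)

text \<open>The next two notions are for a space given by a carrier set \<open>X\<close> and a norm \<open>N\<close> on it.
  Linearity is not part of \<open>bounded_on\<close>; for the shift it is \<open>shift_add\<close> and
  \<open>shift_scale\<close>.\<close>

definition bounded_on :: "'b set \<Rightarrow> ('b \<Rightarrow> real) \<Rightarrow> ('b \<Rightarrow> 'b) \<Rightarrow> bool" where
  "bounded_on X N A \<longleftrightarrow> (\<forall>f\<in>X. A f \<in> X) \<and> (\<exists>C. \<forall>f\<in>X. N (A f) \<le> C * N f)"

definition hypercyclic_on :: "'b::minus set \<Rightarrow> ('b \<Rightarrow> real) \<Rightarrow> ('b \<Rightarrow> 'b) \<Rightarrow> bool" where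
  "hypercyclic_on X N A \<longleftrightarrow>
     (\<exists>x\<in>X. \<forall>y\<in>X. \<forall>\<epsilon>>0. \<exists>n. N ((A ^^ n) x - y) < \<epsilon>)"

end

(* If a and b are two children of one vertex, every function in the range of S takes the same
   value at a and at b. The orbit of x, apart from x itself, hence lies in the kernel of the
   functional f |-> f a - f b, which is continuous because point evaluations are. A multiple of
   the indicator function of a on which this functional avoids the two values 0 and x a - x b
   stays away from the whole orbit. *)
theory Submission
  imports Defs
begin

text \<open>Summability does not depend on a single term. This puts into the space both the function
  \<open>y\<close> to be approximated and the difference \<open>f - y\<close>, which is an orbit
  element altered only at \<open>a\<close>.\<close>

lemma Lp_fun_upd:
  assumes "f \<in> Lp V lam p" and "a \<in> V"
  shows "f(a := z) \<in> Lp V lam p"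
proof -
  have "(\<lambda>v. cmod (f v) powr p * lam v) summable_on V"
    using assms by (simp add: Lp_def)
  then have "(\<lambda>v. cmod (f v) powr p * lam v) summable_on (V - {a})"
    by (rule summable_on_subset_banach) auto
  then have "(\<lambda>v. cmod ((f(a := z)) v) powr p * lam v) summable_on (V - {a})"
    by (rule summable_on_cong[THEN iffD1, rotated]) auto
  then have "(\<lambda>v. cmod ((f(a := z)) v) powr p * lam v) summable_on insert a (V - {a})"
    by (simp only: summable_on_insert_iff)
  moreover have "insert a (V - {a}) = V"
    using assms(2) by auto
  ultimately show ?thesis
    using assms by (auto simp: Lp_def)
qed

text \<open>All terms of the sum are nonnegative, so it dominates its term at \<open>v\<close>. When
  \<open>lam v > 0\<close>, this is continuity of evaluation at \<open>v\<close>.\<close>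

lemma Lp_norm_ge_point:
  assumes "f \<in> Lp V lam p" and "v \<in> V" and "\<forall>w\<in>V. lam w \<ge> 0" and "p > 0"
  shows "cmod (f v) * lam v powr (1 / p) \<le> Lp_norm V lam p f"
proof -
  have "infsum (\<lambda>w. cmod (f w) powr p * lam w) {v} \<le> infsum (\<lambda>w. cmod (f w) powr p * lam w) V"
    using assms by (intro infsum_mono_neutral) (auto simp: Lp_def)
  then have "(cmod (f v) powr p * lam v) powr (1 / p) \<le> Lp_norm V lam p f"
    unfolding Lp_norm_def using assms by (intro powr_mono2) auto
  moreover have "(cmod (f v) powr p * lam v) powr (1 / p) = cmod (f v) * lam v powr (1 / p)"
    using assms by (simp add: powr_mult powr_powr)
  ultimately show ?thesis by simp
qed

text \<open>Indegree at most 1 makes \<open>u\<close> the parent of \<open>a\<close>. The value does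
  not mention \<open>a\<close>, so siblings share it.\<close>

lemma shift_child:
  assumes "directed_tree V E" and "(u, a) \<in> E"
  shows "shift V E f a = f u"
proof -
  have a: "a \<in> V" and fin: "finite {w. (w, a) \<in> E}"
    and deg: "indegree E a = 0 \<or> indegree E a = 1"
    using assms by (auto simp: directed_tree_def locally_finite_digraph_def)
  \<comment> \<open>Finiteness matters here: \<open>card\<close> of an infinite set is 0.\<close>
  have "indegree E a \<noteq> 0"
    using fin assms(2) by (auto simp: indegree_def)
  with deg obtain w where "{t. (t, a) \<in> E} = {w}"
    by (auto simp: indegree_def card_1_singleton_iff)
  then have "(t, a) \<in> E \<longleftrightarrow> t = w" for t
    by blast
  then have "parent E a = u"
    using assms(2) by (simp add: parent_def)
  then show ?thesis
    using a \<open>indegree E a \<noteq> 0\<close> by (simp add: shift_def is_root_def)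
qed

theorem proposition3p4:
  fixes V :: "'v set" and E :: "('v \<times> 'v) set" and lam :: "'v \<Rightarrow> real" and p :: real
  assumes "directed_tree V E"
    and "\<forall>v\<in>V. lam v > 0"
    and "1 \<le> p"
    and "bounded_on (Lp V lam p) (Lp_norm V lam p) (shift V E)"
    and "\<exists>v\<in>V. outdegree E v \<ge> 2"
  shows "\<not> hypercyclic_on (Lp V lam p) (Lp_norm V lam p) (shift V E)"
proof
  assume "hypercyclic_on (Lp V lam p) (Lp_norm V lam p) (shift V E)"
  then obtain x where x: "x \<in> Lp V lam p"
    and dense: "\<And>y \<epsilon>. y \<in> Lp V lam p \<Longrightarrow> \<epsilon> > 0 \<Longrightarrow>
      \<exists>n. Lp_norm V lam p ((shift V E ^^ n) x - y) < \<epsilon>"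
    unfolding hypercyclic_on_def by blast
  obtain u where "2 \<le> card {w. (u, w) \<in> E}"
    using assms(5) by (auto simp: outdegree_def)
  then obtain a b where ab: "(u, a) \<in> E" "(u, b) \<in> E" "a \<noteq> b"
    by (auto simp: card_le_Suc_iff numeral_2_eq_2)
  then have V: "a \<in> V" "b \<in> V"
    using assms(1) by (auto simp: directed_tree_def locally_finite_digraph_def)
  \<comment> \<open>Both 0 and \<open>x a - x b\<close> have modulus at most \<open>c - 1\<close>,
    so \<open>c\<close> has distance at least 1 from each.\<close>
  define c where "c = cmod (x a - x b) + 1"
  define y where "y = (\<lambda>v::'v. 0::complex)(a := of_real c)"
  have "(\<lambda>v. 0) \<in> Lp V lam p"
    by (simp add: Lp_def)
  then have y: "y \<in> Lp V lam p"
    unfolding y_def using V(1) by (rule Lp_fun_upd)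
  \<comment> \<open>A norm below \<open>m / 2\<close> forces the values at \<open>a\<close> and at
    \<open>b\<close> each below 1/2 in modulus, hence their difference below 1.\<close>
  define m where "m = min (lam a powr (1 / p)) (lam b powr (1 / p))"
  have "m > 0"
    using V assms(2) by (auto simp: m_def)
  then obtain n where n: "Lp_norm V lam p ((shift V E ^^ n) x - y) < m / 2"
    using dense[OF y, of "m / 2"] by auto
  define f where "f = (shift V E ^^ n) x"
  have "f \<in> Lp V lam p"
    unfolding f_def using assms(4) x by (induction n) (auto simp: bounded_on_def)
  then have "f(a := f a - of_real c) \<in> Lp V lam p"
    using V(1) by (rule Lp_fun_upd)
  also have "f(a := f a - of_real c) = f - y"
    by (auto simp: y_def)
  finally have fy: "f - y \<in> Lp V lam p" .
  have small: "cmod ((f - y) v) < 1 / 2" if "v = a \<or> v = b" for v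
  proof -
    have "cmod ((f - y) v) * m \<le> cmod ((f - y) v) * lam v powr (1 / p)"
      using that by (intro mult_left_mono) (auto simp: m_def)
    also have "\<dots> \<le> Lp_norm V lam p (f - y)"
      using that V assms(2,3) by (intro Lp_norm_ge_point[OF fy]) (auto intro: less_imp_le)
    also have "\<dots> < 1 / 2 * m"
      using n by (simp add: f_def)
    finally show ?thesis
      using \<open>m > 0\<close> by simp
  qed
  have "cmod ((f - y) a - (f - y) b) < 1"
    using small[OF disjI1[OF refl]] small[OF disjI2[OF refl]]
      norm_triangle_ineq4[of "(f - y) a" "(f - y) b"] by linarith
  also have "(f - y) a - (f - y) b = (f a - f b) - of_real c"
    using ab(3) by (simp add: y_def)
  finally have "cmod (of_real c - (f a - f b)) < 1"
    by (simp add: norm_minus_commute)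
  \<comment> \<open>For \<open>n = 0\<close> the orbit element is \<open>x\<close> itself; otherwise
    the outermost shift copies one value from \<open>u\<close> to both children.\<close>
  moreover have "f a - f b = 0 \<or> f a - f b = x a - x b"
    using ab shift_child[OF assms(1)] by (cases n) (auto simp: f_def)
  then have "cmod (f a - f b) \<le> c - 1"
    by (auto simp: c_def)
  moreover have "c \<le> cmod (of_real c)"
    by simp
  ultimately show False
    using norm_triangle_ineq2[of "of_real c" "f a - f b"] by linarith
qed

end
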